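(* Let $(X,T)$ be the Pascal adic and $(\Sigma,\sigma)$ the countable-substitution subshift. There are a countable subset $X'\subset X$ and a one-to-one Borel measurable map $\phi:X\setminus X'\to\Sigma$ such that $\phi\circ T=\sigma\circ\phi$ on $X\setminus X'$. Consequently, for every $\alpha\in(0,1)$, if $\nu_\alpha=\mu_\alpha\circ\phi^{-1}$, then the systems $(X,T,\mu_\alpha)$ and $(\Sigma,\sigma,\nu_\alpha)$ are measurably isomorphic.
   Context: $X=\{0,1\}^{\mathbb N}$ is the space of sequences $x=x_1x_2x_3\dots$ with the product topology. Pascal adic: let $X_{\max}=\{0^i1^\infty: i\ge 1\}\cup\{0^\infty,1^\infty\}$. Every $x\in X\setminus X_{\max}$ can be written uniquely as $x=0^r1^s10x'$ with $r,s\ge 0$ and $x'\in\{0,1\}^{\mathbb N}$, and $T(0^r1^s10x')=1^s0^r01x'$; $T$ is extended to a bijection of $X$ by $T(0^i1^\infty)=1^i0^\infty$ for $i\ge 1$, $T(0^\infty)=0^\infty$, $T(1^\infty)=1^\infty$. For $\alpha\in(0,1)$, $\mu_\alpha$ is the product (Bernoulli) measure $\mathcal B(\alpha,1-\alpha)$ on $\{0,1\}^{\mathbb N}$ (mass $\alpha$ to $0$ and $1-\alpha$ to $1$); these are the nonatomic ergodic $T$-invariant Borel probability measures on $X$. Subshift: for $i\ge 1$ define words $\zeta_i(j)$, $0\le j\le i$, over $\{a,b\}$ by $\zeta_i(i)=b$ and $\zeta_i(0)=a$ for all $i\ge 1$, and $\zeta_i(j)=\zeta_{i-1}(j)\zeta_{i-1}(j-1)$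 (concatenation) for $i\ge 2$, $0<j<i$. Let $\mathcal L(\zeta)$ be the set of all subwords (contiguous factors) of all words $\zeta_i(j)$, $i\ge 1$, $0\le j\le i$. $\Sigma$ is the set of all sequences in $\{a,b\}^{\mathbb Z}$ all of whose finite subwords belong to $\mathcal L(\zeta)$, and $\sigma$ is the left shift. *)

theory Defs
  imports "HOL-Probability.Probability" "HOL-Library.Omega_Words_Fun" "HOL-Library.Sublist"
begin

section \<open>The Pascal adic transformation\<close>

text \<open>
  The space of 0-1-sequences is the type \<^typ>\<open>nat \<Rightarrow> bool\<close> with the library's product topology, where
  \<^term>\<open>False\<close> stands for the digit 0 and \<^term>\<open>True\<close> for the digit 1. Indices start at 0, so that
  \<open>x 0\<close> is the first digit. Prefixing a finite word is the library operation \<^const>\<open>conc\<close>.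
\<close>

inductive pascal_step :: "(nat \<Rightarrow> bool) \<Rightarrow> (nat \<Rightarrow> bool) \<Rightarrow> bool" where
  generic: "pascal_step
    ((replicate r False @ replicate s True @ [True, False]) \<frown> x')
    ((replicate s True @ replicate r False @ [False, True]) \<frown> x')"
| maximal: "i \<ge> 1 \<Longrightarrow> pascal_step
    (replicate i False \<frown> (\<lambda>_. True))
    (replicate i True \<frown> (\<lambda>_. False))"
| zeros: "pascal_step (\<lambda>_. False) (\<lambda>_. False)"
| ones: "pascal_step (\<lambda>_. True) (\<lambda>_. True)"

definition pascal_adic :: "(nat \<Rightarrow> bool) \<Rightarrow> (nat \<Rightarrow> bool)" where
  "pascal_adic x = (THE y. pascal_step x y)"

text \<open>The Bernoulli measure with mass \<open>\<alpha>\<close> on the digit 0 and mass \<open>1 - \<alpha>\<close> on the digit 1.\<close>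

definition bernoulli_measure :: "real \<Rightarrow> (nat \<Rightarrow> bool) measure" where
  "bernoulli_measure \<alpha> = (\<Pi>\<^sub>M n\<in>UNIV. measure_pmf (bernoulli_pmf (1 - \<alpha>)))"


section \<open>The countable-substitution subshift\<close>

datatype letter = La | Lb

instantiation letter :: discrete_topology
begin

definition open_letter :: "letter set \<Rightarrow> bool" where
  "open_letter U = True"

instance
  by standard (simp_all add: open_letter_def)

end

instance letter :: finite
proof
  have "(UNIV :: letter set) = {La, Lb}"
    by (auto intro: letter.exhaust)
  then show "finite (UNIV :: letter set)"
    by (metis finite.emptyI finite.insertI)
qed

lemma finite_discrete_countable_base:
  "\<exists>B::'a::{finite, discrete_topology} set set. countable B \<and> open = generate_topology B"
proof (intro exI conjI)
  show "countable (UNIV :: 'a set set)"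
    by (rule countable_finite) simp
  show "open = generate_topology (UNIV :: 'a set set)"
    by (intro ext iffI generate_topology.Basis UNIV_I Topological_Spaces.open_discrete)
qed

instance letter :: second_countable_topology
  by standard (rule finite_discrete_countable_base)

instance bool :: second_countable_topology
  by standard (rule finite_discrete_countable_base)

text \<open>
  \<open>zeta_word i j\<close> is meaningful for \<open>i \<ge> 1\<close> and \<open>j \<le> i\<close> only; all other values are dummies
  that no meaningful value depends on.
\<close>

fun zeta_word :: "nat \<Rightarrow> nat \<Rightarrow> letter list" where
  "zeta_word 0 j = []"
| "zeta_word (Suc i) j =
    (if j = 0 then [La]
     else if j = Suc i then [Lb]
     else if j < Suc i then zeta_word i j @ zeta_word i (j - 1)
     else [])"

definition zeta_language :: "letter list set" where
  "zeta_language = {u. \<exists>i j. 1 \<le> i \<and> j \<le> i \<and> sublist u (zeta_word i j)}"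

definition zeta_subshift :: "(int \<Rightarrow> letter) set" where
  "zeta_subshift = {y. \<forall>m n. map y [m..n] \<in> zeta_language}"

definition left_shift :: "(int \<Rightarrow> 'a) \<Rightarrow> (int \<Rightarrow> 'a)" where
  "left_shift y = (\<lambda>n. y (n + 1))"


section \<open>Isomorphism of measure-preserving systems\<close>

definition measure_preserving_system :: "'a measure \<Rightarrow> ('a \<Rightarrow> 'a) \<Rightarrow> bool" where
  "measure_preserving_system M S \<longleftrightarrow>
     prob_space M \<and> S \<in> M \<rightarrow>\<^sub>M M \<and> distr M M S = M"

text \<open>
  Isomorphism modulo null sets: a bimeasurable, measure-preserving, equivariant bijection between
  forward-invariant measurable sets of full measure.
\<close>

definition measurably_isomorphic ::
  "'a measure \<Rightarrow> ('a \<Rightarrow> 'a) \<Rightarrow> 'b measure \<Rightarrow> ('b \<Rightarrow> 'b) \<Rightarrow> bool" where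
  "measurably_isomorphic M S N R \<longleftrightarrow>
     measure_preserving_system M S \<and> measure_preserving_system N R \<and>
     (\<exists>A B h.
        A \<in> sets M \<and> emeasure M A = 1 \<and> S ` A \<subseteq> A \<and>
        B \<in> sets N \<and> emeasure N B = 1 \<and> R ` B \<subseteq> B \<and>
        bij_betw h A B \<and>
        h \<in> restrict_space M A \<rightarrow>\<^sub>M restrict_space N B \<and>
        the_inv_into A h \<in> restrict_space N B \<rightarrow>\<^sub>M restrict_space M A \<and>
        distr (restrict_space M A) (restrict_space N B) h = restrict_space N B \<and>
        (\<forall>x\<in>A. h (S x) = R (h x)))"


section \<open>Well-definedness\<close>

lemma pascal_generic_iff:
  "x = (replicate r False @ replicate s True @ [True, False]) \<frown> x' \<longleftrightarrow>
     (\<forall>n<r. \<not> x n) \<and> (\<forall>n. r \<le> n \<and> n \<le> r + s \<longrightarrow> x n) \<and> \<not> x (Suc (r + s)) \<and>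
     x' = (\<lambda>n. x (r + s + 2 + n))" (is "?L \<longleftrightarrow> ?R")
proof -
  have word: "((replicate r False @ replicate s True @ [True, False]) \<frown> x') n =
      (if n < r then False else if n \<le> r + s then True else if n = Suc (r + s) then False
       else x' (n - (r + s + 2)))" for n
  proof -
    consider "n < r" | "r \<le> n" "n < r + s" | "n = r + s" | "n = Suc (r + s)" | "r + s + 2 \<le> n"
      by linarith
    then show ?thesis
      by cases (simp_all add: conc_def nth_append)
  qed
  show ?thesis
  proof
    assume L: ?L
    have x: "x n = (if n < r then False else if n \<le> r + s then True
        else if n = Suc (r + s) then False else x' (n - (r + s + 2)))" for n
      unfolding word[symmetric] using L by (rule fun_cong)
    show ?R
      by (intro conjI allI impI ext) (simp_all add: x)
  next
    assume R: ?R
    show ?L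
    proof
      fix n
      consider "n < r" | "r \<le> n" "n \<le> r + s" | "n = Suc (r + s)" | k where "n = r + s + 2 + k"
        using nat_le_iff_add[of "r + s + 2" n]
        by (cases "n < r"; cases "n \<le> r + s"; cases "n = Suc (r + s)") auto
      then show "x n = ((replicate r False @ replicate s True @ [True, False]) \<frown> x') n"
        unfolding word using R by cases simp_all
    qed
  qed
qed

lemma pascal_maximal_iff:
  "x = replicate i False \<frown> (\<lambda>_. True) \<longleftrightarrow> (\<forall>n. x n \<longleftrightarrow> i \<le> n)"
proof -
  have "(replicate i False \<frown> (\<lambda>_. True)) n \<longleftrightarrow> i \<le> n" for n
    by (simp add: conc_def)
  then show ?thesis
    by (simp add: fun_eq_iff)
qed

lemma pascal_step_ex1: "\<exists>!y. pascal_step x y"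
proof (rule ex_ex1I)
  show "\<exists>y. pascal_step x y"
  proof (cases "\<exists>n. x n")
    case False
    then have "x = (\<lambda>_. False)" by auto
    then show ?thesis using zeros by blast
  next
    case True
    define r where "r = (LEAST n. x n)"
    have xr: "x r" unfolding r_def using True by (rule LeastI_ex)
    have below: "\<forall>n<r. \<not> x n" unfolding r_def using not_less_Least by blast
    show ?thesis
    proof (cases "\<exists>n>r. \<not> x n")
      case False
      then have x: "x = replicate r False \<frown> (\<lambda>_. True)"
        unfolding pascal_maximal_iff using xr below by (metis le_neq_implies_less not_less)
      show ?thesis
      proof (cases "r = 0")
        case True
        then have "x = (\<lambda>_. True)" using x by simp
        then show ?thesis using ones by blast
      next
        case False
        then show ?thesis using maximal[of r] x by auto
      qed
    next
      case True
      define q where "q = (LEAST n. r < n \<and> \<not> x n)"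
      have q: "r < q" "\<not> x q"
        unfolding q_def using LeastI_ex[OF True] by auto
      have mid: "x n" if "r \<le> n" "n < q" for n
        using that xr not_less_Least[of n "\<lambda>n. r < n \<and> \<not> x n"] unfolding q_def
        by (cases "n = r") auto
      obtain s where s: "q = Suc (r + s)"
        using q(1) less_iff_Suc_add by auto
      have "x = (replicate r False @ replicate s True @ [True, False]) \<frown>
              (\<lambda>n. x (r + s + 2 + n))"
        unfolding pascal_generic_iff using below mid q s by auto
      then show ?thesis using generic by metis
    qed
  qed
next
  have disj: False
    if "x = (replicate r False @ replicate s True @ [True, False]) \<frown> x'"
       "\<forall>n. x n \<longleftrightarrow> i \<le> n" for x r s x' i
    using that unfolding pascal_generic_iff
    by (metis le_SucI le_add1 order_refl order_trans)
  have uniq: "r = r' \<and> s = s' \<and> u = u'"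
    if "x = (replicate r False @ replicate s True @ [True, False]) \<frown> u"
       "x = (replicate r' False @ replicate s' True @ [True, False]) \<frown> u'" for x r s u r' s' u'
  proof -
    note h = that[unfolded pascal_generic_iff]
    have r: "r = r'"
      using h by (metis le_add1 linorder_neqE_nat order_refl)
    have "s = s'"
    proof (rule ccontr)
      assume "s \<noteq> s'"
      then consider "s < s'" | "s' < s" by linarith
      then show False
        using h r by cases auto
    qed
    then show ?thesis using h r by simp
  qed
  fix y z assume y: "pascal_step x y" and z: "pascal_step x z"
  have zero: "x \<noteq> (\<lambda>_. False)"
    if "x = (replicate r False @ replicate s True @ [True, False]) \<frown> u" for r s u
    using that unfolding pascal_generic_iff by auto
  have max: "i = j" if "\<forall>n. x n \<longleftrightarrow> i \<le> n" "\<forall>n. x n \<longleftrightarrow> j \<le> n" for i j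
    using that by (metis order_antisym order_refl)
  show "y = z"
    using y
  proof cases
    case g: (generic r s u)
    from z show ?thesis
    proof cases
      case (generic r' s' u')
      then show ?thesis using g uniq by metis
    next
      case (maximal i)
      then show ?thesis using disj[OF g(1) pascal_maximal_iff[of x i, THEN iffD1]] by simp
    next
      case zeros
      then show ?thesis using zero[OF g(1)] by simp
    next
      case ones
      then show ?thesis using disj[OF g(1), of 0] by simp
    qed
  next
    case m: (maximal i)
    have mi: "\<forall>n. x n \<longleftrightarrow> i \<le> n" using m(1) by (rule pascal_maximal_iff[of x i, THEN iffD1])
    from z show ?thesis
    proof cases
      case (generic r' s' u')
      then show ?thesis using disj mi by blast
    next
      case (maximal j)
      from maximal(1) have "\<forall>n. x n \<longleftrightarrow> j \<le> n" by (rule pascal_maximal_iff[of x j, THEN iffD1])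
      then have "i = j" using max mi by blast
      then show ?thesis using m maximal by simp
    next
      case zeros
      then show ?thesis using mi by auto
    next
      case ones
      then show ?thesis using mi m(3) spec[OF mi, of 0] by simp
    qed
  next
    case o: zeros
    from z show ?thesis
    proof cases
      case (generic r' s' u')
      then show ?thesis using zero o by blast
    next
      case (maximal j)
      from maximal(1) have "\<forall>n. x n \<longleftrightarrow> j \<le> n" by (rule pascal_maximal_iff[of x j, THEN iffD1])
      then show ?thesis using o by auto
    next
      case zeros
      then show ?thesis using o by simp
    next
      case ones
      then show ?thesis using o by (simp add: fun_eq_iff)
    qed
  next
    case o: ones
    from z show ?thesis
    proof cases
      case (generic r' s' u')
      then show ?thesis using disj[of x r' s' u' 0] o(1) by (metis le0)
    next
      case (maximal j)
      from maximal(1) have "\<forall>n. x n \<longleftrightarrow> j \<le> n" by (rule pascal_maximal_iff[of x j, THEN iffD1])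
      then have "j \<le> 0" using o(1) by metis
      then show ?thesis using maximal(3) by simp
    next
      case zeros
      then show ?thesis using o by (simp add: fun_eq_iff)
    next
      case ones
      then show ?thesis using o by simp
    qed
  qed
qed

lemma pascal_adic_eqI: "pascal_step x y \<Longrightarrow> pascal_adic x = y"
  unfolding pascal_adic_def using pascal_step_ex1 by (rule the1_equality)

lemma pascal_adic_generic:
  "pascal_adic ((replicate r False @ replicate s True @ [True, False]) \<frown> x') =
     (replicate s True @ replicate r False @ [False, True]) \<frown> x'"
  by (rule pascal_adic_eqI, rule generic)

lemma pascal_adic_maximal:
  "i \<ge> 1 \<Longrightarrow> pascal_adic (replicate i False \<frown> (\<lambda>_. True)) = replicate i True \<frown> (\<lambda>_. False)"
  by (rule pascal_adic_eqI, rule maximal)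

lemma pascal_adic_zeros: "pascal_adic (\<lambda>_. False) = (\<lambda>_. False)"
  by (rule pascal_adic_eqI, rule zeros)

lemma pascal_adic_ones: "pascal_adic (\<lambda>_. True) = (\<lambda>_. True)"
  by (rule pascal_adic_eqI, rule ones)

lemma zeta_word_0: "1 \<le> i \<Longrightarrow> zeta_word i 0 = [La]"
  by (cases i) auto

lemma zeta_word_diag: "1 \<le> i \<Longrightarrow> zeta_word i i = [Lb]"
  by (cases i) auto

lemma zeta_word_rec:
  "2 \<le> i \<Longrightarrow> 0 < j \<Longrightarrow> j < i \<Longrightarrow> zeta_word i j = zeta_word (i - 1) j @ zeta_word (i - 1) (j - 1)"
  by (cases i) auto

lemma sets_bernoulli_measure: "sets (bernoulli_measure \<alpha>) = sets borel"
proof -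
  have "open S" for S :: "bool set"
    by (rule Topological_Spaces.open_discrete)
  then have "sets (borel :: bool measure) = UNIV"
    by (auto intro: borel_open)
  then have "sets (bernoulli_measure \<alpha>) = sets (\<Pi>\<^sub>M n\<in>(UNIV::nat set). (borel :: bool measure))"
    unfolding bernoulli_measure_def by (intro sets_PiM_cong) auto
  then show ?thesis
    by (simp add: sets_PiM_equal_borel)
qed

end

theory Submission
  imports Defs
begin

text \<open>
  A point of \<open>X\<close> is coded by the first digits along its orbit, and \<open>X'\<close> consists of the eventually
  constant sequences. The orbit of a minimal path to the vertex \<open>(i, j)\<close> of the Pascal graph reads
  the word \<open>\<zeta>\<^sub>i(j)\<close>, so codings lie in \<open>\<Sigma>\<close>.

  The coding is injective by induction on the number of known digits: if the first \<open>N\<close> digits along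
  the orbit are known, follow it to the end of the block, where these digits are \<open>0\<^sup>r1\<^sup>j\<close>. For
  \<open>j > 0\<close>, the number of ones among the first \<open>N\<close> digits drops at the next step iff the digit after
  them is 0; for \<open>j = 0\<close> that digit is 1 iff a one is present one step earlier. Only a bounded
  window of the coding is used for each digit, so decoding extends to a Borel map on \<open>\<Sigma>\<close> and the image
  of the coding is Borel, without an appeal to the Lusin-Souslin theorem.

  The measures are invariant since on every cylinder \<open>0\<^sup>r1\<^sup>s10\<close> the transformation permutes coordinates.
\<close>

section \<open>Orbits of the Pascal adic\<close>

abbreviation (input) flip :: "(nat \<Rightarrow> bool) \<Rightarrow> nat \<Rightarrow> bool" where
  "flip x \<equiv> (\<lambda>n. \<not> x n)"

section \<open>Source and target cylinders of the transformation\<close>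

definition nonconst_seqs :: "(nat \<Rightarrow> bool) set" where
  "nonconst_seqs = {x. infinite {n. x n} \<and> infinite {n. \<not> x n}}"

text \<open>The cylinder \<open>0^r 1^s 1 0\<close>, on which the generic rule with parameters
  \<open>r\<close>, \<open>s\<close> applies. Digit conditions instead of word concatenation suit
  both measurability and permutation arguments.\<close>

definition pascal_source :: "nat \<Rightarrow> nat \<Rightarrow> (nat \<Rightarrow> bool) set" where
  "pascal_source r s = {x. (\<forall>n<r. \<not> x n) \<and> (\<forall>n. r \<le> n \<and> n \<le> r + s \<longrightarrow> x n) \<and> \<not> x (Suc (r + s))}"

text \<open>The cylinder \<open>1^s 0^r 0 1\<close>. Writing it as a flipped source with exchanged
  parameters lets facts about sources carry over to targets.\<close>

definition pascal_target :: "nat \<Rightarrow> nat \<Rightarrow> (nat \<Rightarrow> bool) set" where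
  "pascal_target r s = {x. flip x \<in> pascal_source s r}"

text \<open>The image takes its digit \<open>n\<close> from position
  \<open>pascal_perm r s n\<close>: the blocks \<open>0^r\<close> and \<open>1^s\<close> change
  places and the final pair is swapped.\<close>

definition pascal_perm :: "nat \<Rightarrow> nat \<Rightarrow> nat \<Rightarrow> nat" where
  "pascal_perm r s n =
     (if n < s then n + r else if n < r + s then n - s
      else if n = r + s then Suc n else if n = Suc (r + s) then r + s else n)"

lemma pascal_perm_inverse [simp]: "pascal_perm r s (pascal_perm s r n) = n"
  by (auto simp: pascal_perm_def)

lemma inj_pascal_perm: "inj (pascal_perm r s)"
  by (metis injI pascal_perm_inverse)

text \<open>The equivalence makes the source the full preimage of the target under the coordinate
  permutation, as the invariance of the measures requires.\<close>

lemma pascal_target_iff: "(\<lambda>n. x (pascal_perm r s n)) \<in> pascal_target r s \<longleftrightarrow> x \<in> pascal_source r s"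
proof
  assume *: "x \<in> pascal_source r s"
  then have "x (pascal_perm r s n)" if "n < s" for n
    using that by (simp add: pascal_source_def pascal_perm_def)
  moreover have "\<not> x (pascal_perm r s n)" if "s \<le> n" "n \<le> s + r" for n
    using * that by (cases "n = s + r") (simp_all add: pascal_source_def pascal_perm_def add.commute)
  moreover have "x (pascal_perm r s (Suc (s + r)))"
    using * by (simp add: pascal_source_def pascal_perm_def add.commute)
  ultimately show "(\<lambda>n. x (pascal_perm r s n)) \<in> pascal_target r s"
    by (simp add: pascal_target_def pascal_source_def)
next
  assume *: "(\<lambda>n. x (pascal_perm r s n)) \<in> pascal_target r s"
  \<comment> \<open>For \<open>n < r\<close> the digit \<open>x n\<close> sits at position
    \<open>n + s\<close> of the permuted sequence.\<close>
  have "\<not> x n" if "n < r" for n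
    using * that spec[of _ "n + s"] unfolding pascal_target_def pascal_source_def pascal_perm_def
    by (auto dest!: spec[of _ "n + s"] split: if_splits)
  moreover have "x n" if "r \<le> n" "n < r + s" for n
  proof -
    have "n - r < s" using that by linarith
    then have "x (pascal_perm r s (n - r))"
      using * unfolding pascal_target_def pascal_source_def by simp
    then show ?thesis using that by (auto simp: pascal_perm_def split: if_splits)
  qed
  moreover have "x (r + s)" "\<not> x (Suc (r + s))"
    using * unfolding pascal_target_def pascal_source_def pascal_perm_def
    by (auto simp: add.commute dest!: spec[of _ "r + s"])
  ultimately show "x \<in> pascal_source r s"
    by (auto simp: pascal_source_def dest: le_neq_implies_less)
qed

lemma pascal_adic_source:
  assumes "x \<in> pascal_source r s"
  shows "pascal_adic x = (\<lambda>n. x (pascal_perm r s n))"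
proof -
  have x: "x = (replicate r False @ replicate s True @ [True, False]) \<frown> (\<lambda>n. x (r + s + 2 + n))"
    using assms unfolding pascal_generic_iff pascal_source_def by auto
  have "pascal_adic x n = x (pascal_perm r s n)" for n
  proof -
    have "pascal_adic x n =
        ((replicate s True @ replicate r False @ [False, True]) \<frown> (\<lambda>n. x (r + s + 2 + n))) n"
      by (subst x, subst pascal_adic_generic) (rule refl)
    also have "\<dots> = x (pascal_perm r s n)"
    proof -
      consider "n < s" | "s \<le> n" "n < r + s" | "n = r + s" | "n = Suc (r + s)" | "r + s + 2 \<le> n"
        by linarith
      then show ?thesis
      proof cases
        case 5
        then obtain k where "n = r + s + 2 + k"
          using le_Suc_ex by blast
        then show ?thesis by (simp add: conc_def pascal_perm_def)
      qed (use assms in \<open>simp_all add: conc_def nth_append pascal_perm_def pascal_source_def\<close>)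
    qed
    finally show ?thesis .
  qed
  then show ?thesis ..
qed

lemma nonconst_seqs_source:
  assumes "x \<in> nonconst_seqs"
  obtains r s where "x \<in> pascal_source r s"
proof -
  obtain y where "pascal_step x y"
    using pascal_step_ex1 by blast
  then show thesis
  proof cases
    case (generic r s x')
    then have "x \<in> pascal_source r s"
      unfolding pascal_generic_iff pascal_source_def by blast
    then show thesis by (rule that)
  next
    case (maximal i)
    from maximal(1) have "\<forall>n. x n \<longleftrightarrow> i \<le> n"
      by (rule pascal_maximal_iff[of x i, THEN iffD1])
    then have "{n. \<not> x n} = {..<i}"
      by (simp add: set_eq_iff not_le)
    then have "finite {n. \<not> x n}"
      by simp
    then show thesis
      using assms unfolding nonconst_seqs_def by blast
  qed (use assms in \<open>auto simp: nonconst_seqs_def\<close>)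
qed

lemma flip_nonconst_seqs: "flip x \<in> nonconst_seqs \<longleftrightarrow> x \<in> nonconst_seqs"
  by (auto simp: nonconst_seqs_def)

lemma nonconst_seqs_cong:
  assumes "\<And>n. N \<le> n \<Longrightarrow> x n = y n" and "x \<in> nonconst_seqs"
  shows "y \<in> nonconst_seqs"
  using assms unfolding nonconst_seqs_def infinite_nat_iff_unbounded mem_Collect_eq
  by (metis add_lessD1 less_imp_le max_less_iff_conj)

lemma pascal_adic_nonconst_seqs:
  assumes "x \<in> nonconst_seqs"
  shows "pascal_adic x \<in> nonconst_seqs"
proof -
  obtain r s where x: "x \<in> pascal_source r s"
    using assms by (rule nonconst_seqs_source)
  show ?thesis
  proof (rule nonconst_seqs_cong[OF _ assms])
    fix n assume "r + s + 2 \<le> n"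
    then show "x n = pascal_adic x n"
      by (simp add: pascal_adic_source[OF x] pascal_perm_def)
  qed
qed

text \<open>
  Exchanging the digits turns \<open>0\<^sup>r1\<^sup>s10x'\<close> into \<open>1\<^sup>r0\<^sup>s01\<close> followed by the flipped tail, so it
  conjugates the transformation to its inverse.
\<close>

definition pascal_inverse :: "(nat \<Rightarrow> bool) \<Rightarrow> nat \<Rightarrow> bool" where
  "pascal_inverse x = flip (pascal_adic (flip x))"

lemma pascal_inverse_target:
  assumes "x \<in> pascal_target r s"
  shows "pascal_inverse x = (\<lambda>n. x (pascal_perm s r n))"
  using assms unfolding pascal_inverse_def pascal_target_def by (simp add: pascal_adic_source)

lemma pascal_inverse_nonconst_seqs:
  "x \<in> nonconst_seqs \<Longrightarrow> pascal_inverse x \<in> nonconst_seqs"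
  unfolding pascal_inverse_def flip_nonconst_seqs
  by (intro pascal_adic_nonconst_seqs) (simp only: flip_nonconst_seqs)

lemma pascal_inverse_adic:
  assumes "x \<in> nonconst_seqs"
  shows "pascal_inverse (pascal_adic x) = x"
proof -
  obtain r s where x: "x \<in> pascal_source r s"
    using assms by (rule nonconst_seqs_source)
  then have "pascal_adic x \<in> pascal_target r s"
    by (simp add: pascal_adic_source pascal_target_iff)
  then show ?thesis
    by (simp add: pascal_inverse_target pascal_adic_source[OF x])
qed

lemma pascal_adic_inverse:
  assumes "x \<in> nonconst_seqs"
  shows "pascal_adic (pascal_inverse x) = x"
proof -
  have "flip (pascal_inverse (pascal_adic (flip x))) = x"
    using assms flip_nonconst_seqs[of x] by (simp add: pascal_inverse_adic)
  then show ?thesis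
    by (simp add: pascal_inverse_def)
qed

section \<open>Integer iterates and the coding by first digits\<close>

definition pascal_iter :: "int \<Rightarrow> (nat \<Rightarrow> bool) \<Rightarrow> nat \<Rightarrow> bool" where
  "pascal_iter k x =
     (if 0 \<le> k then (pascal_adic ^^ nat k) x else (pascal_inverse ^^ nat (- k)) x)"

lemma pascal_iter_nonconst_seqs:
  assumes "x \<in> nonconst_seqs"
  shows "pascal_iter k x \<in> nonconst_seqs"
proof -
  have "(pascal_adic ^^ n) x \<in> nonconst_seqs" "(pascal_inverse ^^ n) x \<in> nonconst_seqs" for n
    by (induction n) (simp_all add: assms pascal_adic_nonconst_seqs pascal_inverse_nonconst_seqs)
  then show ?thesis by (simp add: pascal_iter_def)
qed

lemma pascal_iter_0 [simp]: "pascal_iter 0 x = x"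
  by (simp add: pascal_iter_def)

lemma pascal_iter_Suc:
  assumes "x \<in> nonconst_seqs"
  shows "pascal_iter (k + 1) x = pascal_adic (pascal_iter k x)"
proof (cases "0 \<le> k")
  case True
  then show ?thesis by (simp add: pascal_iter_def nat_add_distrib)
next
  case False
  \<comment> \<open>With \<open>k = - (m + 1)\<close> the transformation cancels one of
    \<open>m + 1\<close> inverse steps. The value \<open>m = 0\<close> is split off below because
    \<open>pascal_iter 0\<close> falls under the nonnegative branch.\<close>
  define m where "m = nat (- k - 1)"
  have k: "k = - int (Suc m)" using False by (simp add: m_def)
  have k1: "k + 1 = - int m" using k by simp
  have "(pascal_inverse ^^ m) x \<in> nonconst_seqs"
    using pascal_iter_nonconst_seqs[OF assms, of "- int m"]
    by (cases "m = 0") (simp_all add: pascal_iter_def assms)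
  then have "pascal_adic (pascal_iter k x) = (pascal_inverse ^^ m) x"
    unfolding k by (simp add: pascal_iter_def pascal_adic_inverse nat_add_distrib)
  then show ?thesis
    unfolding k1 by (cases "m = 0") (simp_all add: pascal_iter_def)
qed

lemma pascal_iter_add:
  assumes "x \<in> nonconst_seqs"
  shows "pascal_iter k (pascal_iter l x) = pascal_iter (k + l) x"
proof (induction k rule: int_induct[where k = 0])
  case base
  then show ?case by simp
next
  case (step1 i)
  have "pascal_iter (i + 1) (pascal_iter l x) = pascal_adic (pascal_iter i (pascal_iter l x))"
    by (rule pascal_iter_Suc[OF pascal_iter_nonconst_seqs[OF assms]])
  also have "\<dots> = pascal_iter (i + l + 1) x"
    unfolding step1(2) by (rule pascal_iter_Suc[OF assms, symmetric])
  finally show ?case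
    by (simp add: ac_simps)
next
  case (step2 i)
  let ?y = "pascal_iter (i - 1) (pascal_iter l x)" and ?z = "pascal_iter (i - 1 + l) x"
  \<comment> \<open>Downward step: both sequences have the same image, and
    \<open>pascal_inverse_adic\<close> cancels the transformation.\<close>
  have "pascal_adic ?y = pascal_iter i (pascal_iter l x)"
    using pascal_iter_Suc[OF pascal_iter_nonconst_seqs[OF assms], of "i - 1" l] by simp
  also have "\<dots> = pascal_adic ?z"
    unfolding step2(2) using pascal_iter_Suc[OF assms, of "i - 1 + l"] by (simp add: algebra_simps)
  finally show ?case
    using pascal_inverse_adic pascal_iter_nonconst_seqs assms by metis
qed

lemma pascal_iter_1: "pascal_iter 1 x = pascal_adic x"
  and pascal_iter_minus_1: "pascal_iter (- 1) x = pascal_inverse x"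
  by (simp_all add: pascal_iter_def)

definition letter_of :: "bool \<Rightarrow> letter" where
  "letter_of c = (if c then Lb else La)"

definition pascal_coding :: "(nat \<Rightarrow> bool) \<Rightarrow> int \<Rightarrow> letter" where
  "pascal_coding x k = letter_of (pascal_iter k x 0)"

lemma pascal_coding_iter:
  "x \<in> nonconst_seqs \<Longrightarrow> pascal_coding (pascal_iter l x) k = pascal_coding x (k + l)"
  by (simp add: pascal_coding_def pascal_iter_add)

lemma pascal_coding_adic:
  "x \<in> nonconst_seqs \<Longrightarrow> pascal_coding (pascal_adic x) = left_shift (pascal_coding x)"
  using pascal_coding_iter[of x 1] by (auto simp: pascal_iter_1 left_shift_def)

text \<open>An eventually constant sequence is the indicator of a finite or cofinite set of
  indices.\<close>

lemma countable_nonconst_seqs_compl: "countable (- nonconst_seqs)"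
proof -
  have "countable ((\<lambda>F n. n \<in> F) ` {F::nat set. finite F} \<union> (\<lambda>F n. n \<notin> F) ` {F::nat set. finite F})"
    by (intro countable_Un countable_image countable_Collect_finite)
  moreover have "- nonconst_seqs \<subseteq> (\<lambda>F n. n \<in> F) ` {F::nat set. finite F} \<union> (\<lambda>F n. n \<notin> F) ` {F::nat set. finite F}"
  proof
    fix x assume "x \<in> - nonconst_seqs"
    then consider "finite {n. x n}" | "finite {n. \<not> x n}"
      by (auto simp: nonconst_seqs_def)
    then show "x \<in> (\<lambda>F n. n \<in> F) ` {F::nat set. finite F} \<union> (\<lambda>F n. n \<notin> F) ` {F::nat set. finite F}"
    proof cases
      case 1
      then show ?thesis by (intro UnI1 image_eqI[of _ _ "{n. x n}"]) auto
    next
      case 2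
      then show ?thesis by (intro UnI2 image_eqI[of _ _ "{n. \<not> x n}"]) auto
    qed
  qed
  ultimately show ?thesis by (rule countable_subset[rotated])
qed

section \<open>Blocks and the subshift\<close>

text \<open>For \<open>j \<le> N\<close>, the prefix \<open>1^j 0^(N-j)\<close>: the least path to
  the vertex \<open>(N, j)\<close>, continued by the tail of \<open>x\<close>. The greatest one,
  \<open>max_path\<close>, has the prefix \<open>0^(N-j) 1^j\<close>.\<close>

definition min_path :: "nat \<Rightarrow> nat \<Rightarrow> (nat \<Rightarrow> bool) \<Rightarrow> nat \<Rightarrow> bool" where
  "min_path N j x = (\<lambda>n. if n < N then n < j else x n)"

definition max_path :: "nat \<Rightarrow> nat \<Rightarrow> (nat \<Rightarrow> bool) \<Rightarrow> nat \<Rightarrow> bool" where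
  "max_path N j x = (\<lambda>n. if n < N then N \<le> n + j else x n)"

text \<open>The prefix \<open>0^(N-j) 1^j 0\<close> is the source cylinder with parameters
  \<open>N - j\<close> and \<open>j - 1\<close>. Its final swap moves a one out to position
  \<open>N\<close>, so the orbit passes from block \<open>j\<close> to block \<open>j - 1\<close>,
  in the order of the factors of \<open>zeta_word (Suc N) j\<close>.\<close>

lemma pascal_adic_max_path:
  assumes "1 \<le> j" "j \<le> N" "\<not> x N"
  shows "pascal_adic (max_path N j x) = min_path N (j - 1) (x(N := True))"
proof -
  have src: "max_path N j x \<in> pascal_source (N - j) (j - 1)"
    using assms by (auto simp: pascal_source_def max_path_def)
  show ?thesis
  proof
    fix n
    consider "n < j - 1" | "j - 1 \<le> n" "n < N - 1" | "n = N - 1" | "n = N" | "N < n"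
      by linarith
    then show "pascal_adic (max_path N j x) n = min_path N (j - 1) (x(N := True)) n"
      unfolding pascal_adic_source[OF src] using assms
      by cases (auto simp: min_path_def max_path_def pascal_perm_def)
  qed
qed

lemma min_path_Suc: "j \<le> N \<Longrightarrow> min_path (Suc N) j x = min_path N j (x(N := False))"
  by (auto simp: min_path_def)

lemma max_path_Suc: "1 \<le> j \<Longrightarrow> max_path (Suc N) j x = max_path N (j - 1) (x(N := True))"
  by (auto simp: max_path_def)

lemma zeta_word_nonempty: "1 \<le> N \<Longrightarrow> j \<le> N \<Longrightarrow> zeta_word N j \<noteq> []"
  by (induction N arbitrary: j) auto

text \<open>For \<open>0 < j \<le> N\<close>, the block \<open>j\<close> of level
  \<open>Suc N\<close> consists of a level-\<open>N\<close> block with digit \<open>N\<close> equal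
  to 0 and one with digit \<open>N\<close> equal to 1, joined by
  \<open>pascal_adic_max_path\<close>. Hence the induction needs arbitrary tails \<open>x\<close>,
  and the endpoint is proved along with the letters.\<close>

lemma pascal_adic_block:
  assumes "1 \<le> N" "j \<le> N"
  shows "(pascal_adic ^^ (length (zeta_word N j) - 1)) (min_path N j x) = max_path N j x \<and>
    (\<forall>k < length (zeta_word N j). letter_of ((pascal_adic ^^ k) (min_path N j x) 0) = zeta_word N j ! k)"
  using assms
proof (induction N arbitrary: j x rule: nat_induct_at_least)
  case base
  then have "j = 0 \<or> j = 1" by auto
  then show ?case
    by (auto simp: min_path_def max_path_def letter_of_def fun_eq_iff)
next
  case (Suc N)
  consider "j = 0" | "j = Suc N" | "0 < j" "j \<le> N" using Suc.prems by linarith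
  then show ?case
  proof cases
    case 3
    let ?u = "zeta_word N j" and ?v = "zeta_word N (j - 1)"
    let ?x = "x(N := False)" and ?p = "min_path (Suc N) j x"
    have word: "zeta_word (Suc N) j = ?u @ ?v"
      using 3 by simp
    have ne: "?u \<noteq> []" "?v \<noteq> []"
      using zeta_word_nonempty Suc.hyps 3 by simp_all
    have p: "?p = min_path N j ?x"
      using 3 by (simp add: min_path_Suc)
    note u = Suc.IH[OF 3(2), of ?x, folded p]
    \<comment> \<open>The first \<open>length ?u - 1\<close> steps end at the maximal path of the
      first half; one more crosses into the second half.\<close>
    have "(pascal_adic ^^ length ?u) ?p = pascal_adic ((pascal_adic ^^ (length ?u - 1)) ?p)"
      using ne by (metis Suc_diff_1 comp_apply funpow.simps(2) length_greater_0_conv)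
    also have "\<dots> = min_path N (j - 1) (x(N := True))"
      unfolding conjunct1[OF u] using 3 by (simp add: pascal_adic_max_path)
    finally have mid: "(pascal_adic ^^ (length ?u + k)) ?p =
        (pascal_adic ^^ k) (min_path N (j - 1) (x(N := True)))" for k
      by (metis add.commute comp_apply funpow_add)
    have v: "(pascal_adic ^^ (length ?v - 1)) (min_path N (j - 1) (x(N := True))) =
        max_path N (j - 1) (x(N := True))"
      "\<forall>k < length ?v. letter_of ((pascal_adic ^^ k) (min_path N (j - 1) (x(N := True))) 0) = ?v ! k"
      using Suc.IH[of "j - 1" "x(N := True)"] 3(2) by (meson diff_le_self le_trans)+
    have len: "length (?u @ ?v) - 1 = length ?u + (length ?v - 1)"
      using ne by (simp add: Suc_leI)
    have "letter_of ((pascal_adic ^^ k) ?p 0) = (?u @ ?v) ! k" if "k < length (?u @ ?v)" for k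
    proof (cases "k < length ?u")
      case True
      then show ?thesis using conjunct2[OF u] by (simp add: nth_append)
    next
      case False
      then show ?thesis
        using v(2) that mid[of "k - length ?u"] by (simp add: nth_append)
    qed
    then show ?thesis
      unfolding word len mid v(1) using 3 by (simp add: max_path_Suc)
  qed (auto simp: min_path_def max_path_def letter_of_def fun_eq_iff)
qed

text \<open>A level-\<open>N\<close> block \<open>j < N\<close> with next digit 1 is the second half
  of block \<open>Suc j\<close> one level up, so it starts one word
  \<open>zeta_word N (Suc j)\<close> after the start of that block.\<close>

lemma pascal_adic_block_change:
  assumes "1 \<le> N" "j < N" "x N"
  shows "(pascal_adic ^^ length (zeta_word N (Suc j))) (min_path (Suc N) (Suc j) x) = min_path N j x"
proof -
  let ?x = "x(N := False)" and ?u = "zeta_word N (Suc j)"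
  have "(pascal_adic ^^ length ?u) (min_path (Suc N) (Suc j) x) =
      pascal_adic ((pascal_adic ^^ (length ?u - 1)) (min_path N (Suc j) ?x))"
    using zeta_word_nonempty[of N "Suc j"] assms
    by (metis Suc_diff_1 Suc_leI comp_apply funpow.simps(2) length_greater_0_conv min_path_Suc)
  also have "\<dots> = min_path N j (?x(N := True))"
    using assms pascal_adic_block[of N "Suc j" ?x] by (simp add: pascal_adic_max_path)
  also have "?x(N := True) = x"
    using assms(3) by (auto simp: fun_eq_iff)
  finally show ?thesis .
qed

text \<open>At least \<open>d\<close> letters follow the letter at \<open>x\<close> in its level-\<open>N\<close> block.\<close>

definition block_remaining :: "(nat \<Rightarrow> bool) \<Rightarrow> nat \<Rightarrow> nat \<Rightarrow> bool" where
  "block_remaining x N d \<longleftrightarrow>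
     (\<exists>j\<le>N. \<exists>q. x = (pascal_adic ^^ q) (min_path N j x) \<and> q + d < length (zeta_word N j))"

lemma block_remaining_1: "block_remaining x 1 0"
proof -
  have "x = (pascal_adic ^^ 0) (min_path 1 (of_bool (x 0)) x)"
    by (auto simp: min_path_def fun_eq_iff)
  then show ?thesis
    unfolding block_remaining_def
    by (intro exI[of _ "of_bool (x 0)"] conjI exI[of _ 0]) (auto simp: zeta_word_nonempty)
qed

text \<open>The digit 0 at \<open>N\<close> puts the block into the first half of the larger one,
  and the nonempty second half supplies the extra letter. A one among the first \<open>N\<close>
  digits excludes \<open>j = 0\<close>, whose word is a single letter at every level.\<close>

lemma block_remaining_Suc_zero:
  assumes "1 \<le> N" "block_remaining x N d" "\<not> x N" "\<exists>i<N. x i"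
  shows "block_remaining x (Suc N) (Suc d)"
proof -
  obtain j q where j: "j \<le> N" and x: "x = (pascal_adic ^^ q) (min_path N j x)"
    and q: "q + d < length (zeta_word N j)"
    using assms(2) unfolding block_remaining_def by auto
  have "j \<noteq> 0"
  proof
    assume "j = 0"
    then have "x = min_path N 0 x"
      using x q assms(1) by (simp add: zeta_word_0)
    then show False
      using assms(4) by (metis min_path_def not_less0)
  qed
  have "x(N := False) = x"
    using assms(3) by (auto simp: fun_eq_iff)
  then have "x = (pascal_adic ^^ q) (min_path (Suc N) j x)"
    using x j by (simp add: min_path_Suc)
  moreover have "q + Suc d < length (zeta_word (Suc N) j)"
    using q j \<open>j \<noteq> 0\<close> zeta_word_nonempty[of N "j - 1"] assms(1)
    by (cases "zeta_word N (j - 1)") auto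
  ultimately show ?thesis
    unfolding block_remaining_def using le_SucI[OF j] by blast
qed

text \<open>A digit 0 at \<open>N\<close> keeps the offset \<open>q\<close>, a digit 1 adds the
  length of the first half to it. For \<open>j = N\<close> and digit 1 the prefix is all ones and
  the larger block is again a single letter.\<close>

lemma block_remaining_Suc:
  assumes "1 \<le> N" "block_remaining x N d"
  shows "block_remaining x (Suc N) d"
proof -
  obtain j q where j: "j \<le> N" and x: "x = (pascal_adic ^^ q) (min_path N j x)"
    and q: "q + d < length (zeta_word N j)"
    using assms(2) unfolding block_remaining_def by auto
  consider "\<not> x N" | "x N" "j < N" | "x N" "j = N"
    using j by fastforce
  then show ?thesis
  proof cases
    case 1
    then have "x(N := False) = x"
      by (auto simp: fun_eq_iff)
    then have "x = (pascal_adic ^^ q) (min_path (Suc N) j x)"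
      using x j by (simp add: min_path_Suc)
    moreover have "q + d < length (zeta_word (Suc N) j)"
      using q j assms(1) by (cases "j = 0") (simp_all add: zeta_word_0)
    ultimately show ?thesis
      unfolding block_remaining_def using le_SucI[OF j] by blast
  next
    case 2
    have "x = (pascal_adic ^^ (q + length (zeta_word N (Suc j)))) (min_path (Suc N) (Suc j) x)"
      using x pascal_adic_block_change[OF assms(1) 2(2), of x] 2(1) by (simp add: funpow_add)
    moreover have "q + length (zeta_word N (Suc j)) + d < length (zeta_word (Suc N) (Suc j))"
      using q 2(2) by simp
    ultimately show ?thesis
      unfolding block_remaining_def using Suc_le_mono[THEN iffD2, OF j] by blast
  next
    case 3
    then have "q = 0" "d = 0"
      using q assms(1) by (simp_all add: zeta_word_diag)
    then have "x = min_path N N x"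
      using x 3 by simp
    then have "x i" if "i < N" for i
      using that by (metis min_path_def)
    then have "min_path (Suc N) (Suc N) x = x"
      using 3(1) by (auto simp: min_path_def less_Suc_eq)
    then have "x = (pascal_adic ^^ 0) (min_path (Suc N) (Suc N) x)"
      by simp
    moreover have "0 + d < length (zeta_word (Suc N) (Suc N))"
      using \<open>d = 0\<close> by simp
    ultimately show ?thesis
      unfolding block_remaining_def by blast
  qed
qed

lemma block_remaining_le:
  assumes "1 \<le> N" "N \<le> M" "block_remaining x N d"
  shows "block_remaining x M d"
  using assms(2,3,1) by (induction M rule: dec_induct) (auto intro: block_remaining_Suc)

lemma ex_block_remaining:
  assumes "x \<in> nonconst_seqs"
  shows "\<exists>N\<ge>1. block_remaining x N d"
proof (induction d)
  case 0
  then show ?case using block_remaining_1 by blast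
next
  case (Suc d)
  then obtain N where N: "1 \<le> N" "block_remaining x N d" by blast
  have inf: "infinite {n. x n}" "infinite {n. \<not> x n}"
    using assms by (auto simp: nonconst_seqs_def)
  obtain i where i: "x i"
    using infinite_imp_nonempty[OF inf(1)] by blast
  \<comment> \<open>At a zero beyond both \<open>N\<close> and some one,
    \<open>block_remaining_Suc_zero\<close> gains the next letter.\<close>
  have "\<exists>M>max N i. M \<in> {n. \<not> x n}"
    using inf(2) unfolding infinite_nat_iff_unbounded by blast
  then obtain M where "max N i < M" and zero: "\<not> x M"
    by blast
  then have M: "N \<le> M" "i < M"
    by simp_all
  have "block_remaining x M d"
    using N(1) M(1) N(2) by (rule block_remaining_le)
  moreover have "1 \<le> M" "\<exists>i<M. x i"
    using N(1) M i by auto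
  ultimately have "block_remaining x (Suc M) (Suc d)"
    using zero by (intro block_remaining_Suc_zero)
  then show ?case by (intro exI[of _ "Suc M"]) simp
qed

text \<open>Moving the base point to the \<open>m\<close>-th iterate makes the window one-sided, so
  it suffices that enough letters follow the base point within one block.\<close>

lemma pascal_coding_subshift:
  assumes "x \<in> nonconst_seqs"
  shows "pascal_coding x \<in> zeta_subshift"
  unfolding zeta_subshift_def
proof (intro CollectI allI)
  fix m n
  define u where "u = pascal_iter m x"
  define d where "d = nat (n - m)"
  have u: "u \<in> nonconst_seqs"
    unfolding u_def using assms by (rule pascal_iter_nonconst_seqs)
  obtain N where N: "1 \<le> N" and "block_remaining u N d"
    using ex_block_remaining[OF u] by blast
  then obtain j q where j: "j \<le> N" and uq: "u = (pascal_adic ^^ q) (min_path N j u)"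
    and q: "q + d < length (zeta_word N j)"
    unfolding block_remaining_def by auto
  have letter: "pascal_coding x (m + int k) = zeta_word N j ! (q + k)" if "k \<le> d" for k
  proof -
    have "pascal_coding x (m + int k) = letter_of ((pascal_adic ^^ k) u 0)"
      using pascal_coding_iter[OF assms, of m "int k"]
      by (simp add: u_def pascal_coding_def pascal_iter_def add.commute)
    also have "(pascal_adic ^^ k) u = (pascal_adic ^^ (q + k)) (min_path N j u)"
      by (subst uq) (metis add.commute comp_apply funpow_add)
    finally show ?thesis
      using pascal_adic_block[OF N j] q that by simp
  qed
  have "sublist (map (pascal_coding x) [m..n]) (zeta_word N j)"
  proof (cases "m \<le> n")
    case True
    have "map (pascal_coding x) [m..n] = take (Suc d) (drop q (zeta_word N j))"
      using True q letter by (intro nth_equalityI) (auto simp: d_def)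
    then show ?thesis
      by (metis sublist_drop sublist_order.order_trans sublist_take)
  qed simp
  then show "map (pascal_coding x) [m..n] \<in> zeta_language"
    unfolding zeta_language_def using N j by blast
qed

section \<open>Decoding\<close>

lemma nonconst_seqs_target:
  assumes "x \<in> nonconst_seqs"
  obtains r s where "x \<in> pascal_target r s"
  using assms unfolding pascal_target_def
  by (metis flip_nonconst_seqs mem_Collect_eq nonconst_seqs_source)

lemma pascal_adic_target: "x \<in> pascal_source r s \<Longrightarrow> pascal_adic x \<in> pascal_target r s"
  by (simp add: pascal_adic_source pascal_target_iff)

lemma pascal_inverse_source:
  assumes "x \<in> pascal_target r s"
  shows "pascal_inverse x \<in> pascal_source r s"
  using assms pascal_target_iff[of "\<lambda>n. x (pascal_perm s r n)" r s]
  by (simp add: pascal_inverse_target)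

section \<open>Recovering digits from a bounded window of the coding\<close>

text \<open>Later digits weigh more, and the last digit changed by a generic step goes from 0 to 1.
  So the value grows at each step confined to the first \<open>N\<close> digits, and its bound
  \<open>2 ^ N\<close> limits how many such steps follow one another.\<close>

definition binary_value :: "nat \<Rightarrow> (nat \<Rightarrow> bool) \<Rightarrow> nat" where
  "binary_value N x = (\<Sum>i<N. of_bool (x i) * 2 ^ i)"

lemma binary_value_less: "binary_value N x < 2 ^ N"
  by (induction N) (auto simp: binary_value_def)

lemma binary_value_mono:
  assumes "m < N" "\<not> x m" "y m" "\<And>i. m < i \<Longrightarrow> x i = y i"
  shows "binary_value N x < binary_value N y"
  using assms(1)
proof (induction N)
  case (Suc N)
  show ?case
  proof (cases "m = N")
    case True
    then show ?thesis
      using assms(2,3) binary_value_less[of N x] by (simp add: binary_value_def)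
  next
    case False
    then show ?thesis
      using Suc assms(4)[of N] by (simp add: binary_value_def)
  qed
qed simp

text \<open>The bounds \<open>N \<le> Suc (r + s)\<close> and \<open>N \<le> Suc (r' + s')\<close>
  say that both prefixes have the form \<open>0^p 1^q\<close>, the end of a level-\<open>N\<close>
  block. One step forward and one step back then suffice to tell the next digits apart.\<close>

lemma digit_after_block:
  assumes x: "x \<in> nonconst_seqs" "x \<in> pascal_source r s" "N \<le> Suc (r + s)"
    and y: "y \<in> nonconst_seqs" "y \<in> pascal_source r' s'" "N \<le> Suc (r' + s')"
    and N: "1 \<le> N"
    and agree: "\<And>i. i < N \<Longrightarrow> x i = y i"
    and next_agree: "\<And>i. i < N \<Longrightarrow> pascal_adic x i = pascal_adic y i"
    and prev_agree: "\<And>i. i < N \<Longrightarrow> pascal_inverse x i = pascal_inverse y i"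
    and "\<not> x N" "y N"
  shows False
proof (cases "\<exists>i<N. x i")
  case True
  have "r < N"
    using True x(2) unfolding pascal_source_def by (metis (mono_tags) le_less_trans mem_Collect_eq not_le)
  then have "\<not> N \<le> r + s"
    using x(2) \<open>\<not> x N\<close> unfolding pascal_source_def by auto
  then have N: "N = Suc (r + s)"
    using x(3) by simp
  have "x r" "y r"
    using x(2) agree \<open>r < N\<close> by (auto simp: pascal_source_def)
  have "r' = r"
  proof (rule linorder_cases)
    assume "r' < r"
    then have "y r'" "\<not> x r'"
      using x(2) y(2) by (auto simp: pascal_source_def)
    then show ?thesis using agree[of r'] \<open>r' < r\<close> \<open>r < N\<close> by simp
  next
    assume "r < r'"
    then show ?thesis using \<open>y r\<close> y(2) by (auto simp: pascal_source_def)
  qed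
  have "N \<noteq> Suc (r' + s')"
    using y(2) \<open>y N\<close> by (auto simp: pascal_source_def)
  then have "s < s'"
    using y(3) N \<open>r' = r\<close> by simp
  \<comment> \<open>After the step, \<open>x\<close> begins with exactly \<open>s\<close> ones and
    \<open>y\<close> with at least \<open>Suc s\<close>; since \<open>s < N\<close>, the difference
    is visible.\<close>
  have "\<not> pascal_adic x s"
    using pascal_adic_target[OF x(2)] by (auto simp: pascal_target_def pascal_source_def)
  moreover have "pascal_adic y s"
    using pascal_adic_target[OF y(2)] \<open>s < s'\<close> by (auto simp: pascal_target_def pascal_source_def)
  ultimately show False
    using next_agree[of s] N by simp
next
  case False
  \<comment> \<open>Such a \<open>z\<close> starts with \<open>0^(\<rho>+1) 1\<close> and its
    preimage with \<open>0^\<rho> 1 0\<close>: the first one moves a single place forward under the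
    transformation. It is at \<open>N - 1\<close> in the preimage iff it is at \<open>N\<close> in
    \<open>z\<close>.\<close>
  have tail: "\<exists>\<rho>. pascal_inverse z \<in> pascal_source \<rho> 0 \<and> N \<le> Suc \<rho> \<and> z (Suc \<rho>) \<and> (\<forall>n\<le>\<rho>. \<not> z n)"
    if z: "z \<in> nonconst_seqs" "\<forall>i<N. \<not> z i" for z
  proof -
    obtain \<rho> \<sigma> where t: "z \<in> pascal_target \<rho> \<sigma>"
      using z(1) by (rule nonconst_seqs_target)
    have "\<sigma> = 0"
      using t z(2) N by (cases \<sigma>) (auto simp: pascal_target_def pascal_source_def)
    then have "z (Suc \<rho>)" "\<forall>n\<le>\<rho>. \<not> z n"
      using t by (auto simp: pascal_target_def pascal_source_def)
    moreover from this have "N \<le> Suc \<rho>"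
      using z(2) by (meson not_le)
    ultimately show ?thesis
      using pascal_inverse_source[OF t] \<open>\<sigma> = 0\<close> by blast
  qed
  obtain \<rho> where \<rho>: "pascal_inverse x \<in> pascal_source \<rho> 0" "N \<le> Suc \<rho>" "x (Suc \<rho>)"
    using tail[OF x(1)] False by blast
  obtain \<rho>' where \<rho>': "pascal_inverse y \<in> pascal_source \<rho>' 0" "N \<le> Suc \<rho>'" "\<forall>n\<le>\<rho>'. \<not> y n"
    using tail[OF y(1)] False agree by blast
  have "N \<noteq> Suc \<rho>"
    using \<rho>(3) \<open>\<not> x N\<close> by blast
  then have "\<not> pascal_inverse x (N - 1)"
    using \<rho>(1,2) N by (auto simp: pascal_source_def)
  moreover have "\<rho>' = N - 1"
    using \<rho>'(2,3) \<open>y N\<close> by (metis diff_Suc_1 le_SucE)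
  then have "pascal_inverse y (N - 1)"
    using \<rho>'(1) by (auto simp: pascal_source_def)
  ultimately show False
    using prev_agree[of "N - 1"] N by simp
qed

text \<open>Induction on the bound \<open>L\<close> for the number of steps left before the end of
  the block, where \<open>digit_after_block\<close> decides. That lemma also looks one step back,
  hence the window starts at \<open>- 1\<close>.\<close>

lemma digit_determined:
  assumes "x \<in> nonconst_seqs" "y \<in> nonconst_seqs" "1 \<le> N"
    and "2 ^ N \<le> binary_value N x + L"
    and "\<And>k i. - 1 \<le> k \<Longrightarrow> k \<le> int L \<Longrightarrow> i < N \<Longrightarrow> pascal_iter k x i = pascal_iter k y i"
  shows "x N = y N"
  using assms
proof (induction L arbitrary: x y)
  case 0
  then show ?case using binary_value_less[of N x] by simp
next
  case (Suc L)
  have agree: "x i = y i" "pascal_adic x i = pascal_adic y i" "pascal_inverse x i = pascal_inverse y i"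
    if "i < N" for i
    using Suc.prems(5)[of 0 i] Suc.prems(5)[of 1 i] Suc.prems(5)[of "- 1" i] that
    by (simp_all add: pascal_iter_1 pascal_iter_minus_1)
  obtain r s where x: "x \<in> pascal_source r s"
    using Suc.prems(1) by (rule nonconst_seqs_source)
  obtain r' s' where y: "y \<in> pascal_source r' s'"
    using Suc.prems(2) by (rule nonconst_seqs_source)
  \<comment> \<open>Before the end of the block, a step leaves digit \<open>N\<close> alone and
    raises \<open>binary_value\<close>, so the claim passes to the images with \<open>L\<close> in
    place of \<open>Suc L\<close>.\<close>
  have inner: "x N = y N" if src: "x \<in> pascal_source a b" "y \<in> pascal_source a b" and len: "Suc (a + b) < N" for a b
  proof -
    have tail: "pascal_adic z i = z i" if "z \<in> pascal_source a b" "Suc (a + b) < i" for z i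
      using that by (simp add: pascal_adic_source pascal_perm_def)
    have "binary_value N x < binary_value N (pascal_adic x)"
    proof (rule binary_value_mono[OF len])
      show "\<not> x (Suc (a + b))" "pascal_adic x (Suc (a + b))"
        using src(1) pascal_adic_target[OF src(1)] by (auto simp: pascal_source_def pascal_target_def add.commute)
    qed (simp add: tail[OF src(1)])
    then have bound: "2 ^ N \<le> binary_value N (pascal_adic x) + L"
      using Suc.prems(4) by simp
    have iter: "pascal_iter k (pascal_adic x) i = pascal_iter k (pascal_adic y) i"
      if "- 1 \<le> k" "k \<le> int L" "i < N" for k i
      using Suc.prems(5)[of "k + 1" i] that pascal_iter_add[OF Suc.prems(1), of k 1]
        pascal_iter_add[OF Suc.prems(2), of k 1]
      by (simp add: pascal_iter_1)
    have "pascal_adic x N = pascal_adic y N"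
      using pascal_adic_nonconst_seqs[OF Suc.prems(1)] pascal_adic_nonconst_seqs[OF Suc.prems(2)]
        Suc.prems(3) bound iter by (rule Suc.IH)
    then show ?thesis
      using tail[OF src(1) len] tail[OF src(2) len] by simp
  qed
  \<comment> \<open>Membership reads only the digits up to \<open>Suc (a + b)\<close>, on which the
    two sequences agree.\<close>
  have transfer: "v \<in> pascal_source a b"
    if "u \<in> pascal_source a b" "Suc (a + b) < N" "\<And>i. i < N \<Longrightarrow> u i = v i" for u v a b
    using that by (simp add: pascal_source_def)
  consider "Suc (r + s) < N" | "Suc (r' + s') < N" | "N \<le> Suc (r + s)" "N \<le> Suc (r' + s')"
    by linarith
  then show ?case
  proof cases
    case 1
    then show ?thesis using inner x transfer[OF x, of y] agree(1) by blast
  next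
    case 2
    then show ?thesis using inner y transfer[OF y, of x] agree(1) by metis
  next
    case 3
    show ?thesis
    proof (rule ccontr)
      assume "x N \<noteq> y N"
      then consider "\<not> x N" "y N" | "\<not> y N" "x N" by blast
      then show False
      proof cases
        case 1
        then show False
          using digit_after_block[OF Suc.prems(1) x 3(1) Suc.prems(2) y 3(2) Suc.prems(3)] agree by blast
      next
        case 2
        then show False
          using digit_after_block[OF Suc.prems(2) y 3(2) Suc.prems(1) x 3(1) Suc.prems(3)] agree by blast
      qed
    qed
  qed
qed

text \<open>The radius is uniform in \<open>x\<close> and \<open>y\<close>, so each digit can be
  decoded from a fixed finite window.\<close>

lemma ex_coding_window:
  "\<exists>K. \<forall>x\<in>nonconst_seqs. \<forall>y\<in>nonconst_seqs.
     (\<forall>k. \<bar>k\<bar> \<le> int K \<longrightarrow> pascal_coding x k = pascal_coding y k) \<longrightarrow> (\<forall>i<N. x i = y i)"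
proof (induction N)
  case 0
  then show ?case by simp
next
  case (Suc N)
  then obtain K where K: "\<And>x y i. x \<in> nonconst_seqs \<Longrightarrow> y \<in> nonconst_seqs \<Longrightarrow>
      (\<And>k. \<bar>k\<bar> \<le> int K \<Longrightarrow> pascal_coding x k = pascal_coding y k) \<Longrightarrow> i < N \<Longrightarrow> x i = y i"
    by blast
  show ?case
  \<comment> \<open>\<open>L = 2 ^ N\<close> satisfies the bound of \<open>digit_determined\<close>
    for every \<open>x\<close>; each of the iterates involved brings its own window of radius
    \<open>K\<close>.\<close>
  proof (intro exI[of _ "K + 2 ^ N"] ballI impI allI)
    fix x y i
    assume x: "x \<in> nonconst_seqs" and y: "y \<in> nonconst_seqs"
      and eq: "\<forall>k. \<bar>k\<bar> \<le> int (K + 2 ^ N) \<longrightarrow> pascal_coding x k = pascal_coding y k"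
      and i: "i < Suc N"
    have agree: "pascal_iter l x i = pascal_iter l y i" if l: "- 1 \<le> l" "l \<le> 2 ^ N" and "i < N" for l i
    proof (rule K[OF pascal_iter_nonconst_seqs[OF x] pascal_iter_nonconst_seqs[OF y] _ \<open>i < N\<close>])
      fix k :: int assume k: "\<bar>k\<bar> \<le> int K"
      have "(1::int) \<le> 2 ^ N"
        by simp
      then have "\<bar>l\<bar> \<le> 2 ^ N"
        using l by linarith
      then have "\<bar>k + l\<bar> \<le> int (K + 2 ^ N)"
        using k by simp
      then show "pascal_coding (pascal_iter l x) k = pascal_coding (pascal_iter l y) k"
        using eq by (simp add: pascal_coding_iter x y)
    qed
    have "x N = y N"
    proof (cases "N = 0")
      case True
      have "pascal_coding x 0 = pascal_coding y 0"
        using eq by simp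
      then show ?thesis
        by (simp add: True pascal_coding_def letter_of_def split: if_splits)
    next
      case False
      then have "1 \<le> N"
        by simp
      then show ?thesis
        using x y agree by (intro digit_determined[where L = "2 ^ N" and x = x and y = y]) simp_all
    qed
    then show "x i = y i"
      using i agree[of 0 i] by (auto simp: less_Suc_eq)
  qed
qed

definition coding_window :: "nat \<Rightarrow> nat" where
  "coding_window N = (SOME K. \<forall>x\<in>nonconst_seqs. \<forall>y\<in>nonconst_seqs.
     (\<forall>k. \<bar>k\<bar> \<le> int K \<longrightarrow> pascal_coding x k = pascal_coding y k) \<longrightarrow> (\<forall>i<N. x i = y i))"

lemma coding_window:
  assumes "x \<in> nonconst_seqs" "y \<in> nonconst_seqs"
    and "\<And>k. \<bar>k\<bar> \<le> int (coding_window N) \<Longrightarrow> pascal_coding x k = pascal_coding y k" and "i < N"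
  shows "x i = y i"
  using someI_ex[OF ex_coding_window[of N]] assms unfolding coding_window_def[symmetric] by blast

text \<open>The existential form is total and makes the set of \<open>y\<close> with decoded digit 1
  at \<open>n\<close> a union of cylinders. On codings \<open>coding_window\<close> makes the digit
  independent of the witness.\<close>

definition pascal_decode :: "(int \<Rightarrow> letter) \<Rightarrow> nat \<Rightarrow> bool" where
  "pascal_decode y n \<longleftrightarrow> (\<exists>x\<in>nonconst_seqs. x n \<and>
     (\<forall>k. \<bar>k\<bar> \<le> int (coding_window (Suc n)) \<longrightarrow> pascal_coding x k = y k))"

lemma pascal_decode_coding:
  assumes "x \<in> nonconst_seqs"
  shows "pascal_decode (pascal_coding x) = x"
proof
  fix n
  show "pascal_decode (pascal_coding x) n = x n"
  proof
    assume "pascal_decode (pascal_coding x) n"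
    then obtain x' where x': "x' \<in> nonconst_seqs" "x' n"
      and agree: "\<And>k. \<bar>k\<bar> \<le> int (coding_window (Suc n)) \<Longrightarrow> pascal_coding x' k = pascal_coding x k"
      unfolding pascal_decode_def by blast
    have "x' n = x n"
      by (rule coding_window[of x' x "Suc n" n, OF x'(1) assms agree lessI])
    then show "x n"
      using x'(2) by simp
  next
    assume "x n"
    then show "pascal_decode (pascal_coding x) n"
      unfolding pascal_decode_def using assms by blast
  qed
qed

text \<open>Passes between the Borel-valued form used for product topologies and the
  \<open>count_space\<close> form in which predicates are measured.\<close>

lemma borel_measurable_countable_iff:
  fixes f :: "'a \<Rightarrow> 'b::{countable, t2_space}"
  shows "f \<in> borel_measurable M \<longleftrightarrow> f \<in> M \<rightarrow>\<^sub>M count_space UNIV"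
proof -
  have "borel_measurable M = M \<rightarrow>\<^sub>M (count_space UNIV :: 'b measure)"
    by (rule measurable_cong_sets[OF refl sets_borel_eq_count_space])
  then show ?thesis
    by (rule eqset_imp_iff)
qed

lemma measurable_pascal_decode: "pascal_decode \<in> borel_measurable borel"
proof (rule measurable_coordinatewise_then_product)
  fix n
  let ?C = "\<lambda>x. {y. \<forall>k\<in>{- int (coding_window (Suc n))..int (coding_window (Suc n))}. pascal_coding x k = y k}"
  have "open (?C x)" for x
  proof -
    have "open {y. pascal_coding x k = y k}" for k
    proof -
      have "open ((\<lambda>y::int \<Rightarrow> letter. y k) -` {pascal_coding x k})"
        by (intro open_vimage continuous_on_product_coordinates Topological_Spaces.open_discrete)
      also have "(\<lambda>y. y k) -` {pascal_coding x k} = {y. pascal_coding x k = y k}"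
        by auto
      finally show ?thesis .
    qed
    moreover have "?C x = (\<Inter>k\<in>{- int (coding_window (Suc n))..int (coding_window (Suc n))}.
        {y. pascal_coding x k = y k})"
      by auto
    ultimately show ?thesis
      by (simp add: open_INT)
  qed
  \<comment> \<open>The index set is uncountable; openness of the cylinders is what makes the union
    Borel.\<close>
  then have "open (\<Union>x\<in>{x\<in>nonconst_seqs. x n}. ?C x)"
    by blast
  also have "(\<Union>x\<in>{x\<in>nonconst_seqs. x n}. ?C x) = {y. pascal_decode y n}"
    by (auto simp: pascal_decode_def abs_le_iff)
  finally have "{y \<in> space borel. pascal_decode y n} \<in> sets borel"
    by simp
  then show "(\<lambda>y. pascal_decode y n) \<in> borel_measurable borel"
    unfolding borel_measurable_countable_iff pred_def .
qed

section \<open>Measurability\<close>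

lemma pred_digit [measurable]: "Measurable.pred borel (\<lambda>x::nat \<Rightarrow> bool. x n)"
proof -
  have "(\<lambda>x::nat \<Rightarrow> bool. x n) \<in> borel_measurable borel"
    by (rule measurable_product_then_coordinatewise[OF measurable_ident_sets[OF refl]])
  then show ?thesis
    unfolding borel_measurable_countable_iff .
qed

lemma measurable_letter [measurable]:
  "(\<lambda>y::int \<Rightarrow> letter. y k) \<in> borel \<rightarrow>\<^sub>M count_space UNIV"
proof -
  have "(\<lambda>y::int \<Rightarrow> letter. y k) \<in> borel_measurable borel"
    by (rule measurable_product_then_coordinatewise[OF measurable_ident_sets[OF refl]])
  then show ?thesis
    unfolding borel_measurable_countable_iff .
qed

lemma borel_measurable_sequenceI:
  fixes f :: "'a \<Rightarrow> nat \<Rightarrow> bool"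
  assumes "\<And>n. Measurable.pred M (\<lambda>x. f x n)"
  shows "f \<in> borel_measurable M"
proof (rule measurable_coordinatewise_then_product)
  show "(\<lambda>x. f x n) \<in> borel_measurable M" for n
    unfolding borel_measurable_countable_iff by (rule assms)
qed

lemma sets_pascal_source [measurable]: "pascal_source r s \<in> sets borel"
proof -
  have "{x \<in> space borel. (\<forall>n<r. \<not> x n) \<and> (\<forall>n. r \<le> n \<and> n \<le> r + s \<longrightarrow> x n) \<and> \<not> x (Suc (r + s))} \<in> sets borel"
    by measurable
  then show ?thesis
    by (simp add: pascal_source_def)
qed

lemma measurable_reindex: "(\<lambda>x n. x (f n)) \<in> (borel :: (nat \<Rightarrow> bool) measure) \<rightarrow>\<^sub>M (borel :: (nat \<Rightarrow> bool) measure)"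
  by (intro borel_measurable_sequenceI pred_digit)

lemma measurable_flip: "(\<lambda>x n. \<not> x n) \<in> (borel :: (nat \<Rightarrow> bool) measure) \<rightarrow>\<^sub>M (borel :: (nat \<Rightarrow> bool) measure)"
  by (intro borel_measurable_sequenceI pred_intros_logic pred_digit)

lemma sets_countable_sequences:
  assumes "countable (X :: (nat \<Rightarrow> bool) set)"
  shows "X \<in> sets borel"
proof (rule sets.countable[OF _ assms])
  fix x :: "nat \<Rightarrow> bool"
  have "{y \<in> space borel. \<forall>n. y n = x n} \<in> sets borel"
    by measurable
  then show "{x} \<in> sets borel"
    by (simp add: fun_eq_iff[symmetric])
qed

lemma sets_nonconst_seqs [measurable]: "nonconst_seqs \<in> sets borel"
  using sets.compl_sets[OF sets_countable_sequences[OF countable_nonconst_seqs_compl]]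
  by (simp add: Compl_eq_Diff_UNIV double_diff)

section \<open>Measurability of the transformation, the coding and its image\<close>

lemma measurable_pascal_adic: "pascal_adic \<in> borel \<rightarrow>\<^sub>M borel"
proof (rule measurable_piecewise_restrict)
  \<comment> \<open>Countably many pieces: coordinate permutations on the source cylinders,
    constants on the single eventually constant sequences.\<close>
  let ?C = "range (\<lambda>(r, s). pascal_source r s) \<union> (\<lambda>x. {x}) ` (- nonconst_seqs)"
  show "countable ?C"
    by (intro countable_Un countable_image countable_nonconst_seqs_compl) simp_all
  show "\<Omega> \<inter> space borel \<in> sets borel" if "\<Omega> \<in> ?C" for \<Omega>
    using that sets_pascal_source by (auto simp: sets_countable_sequences)
  show "space borel \<subseteq> \<Union>?C"
  proof
    fix x show "x \<in> \<Union>?C"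
    proof (cases "x \<in> nonconst_seqs")
      case True
      then obtain r s where "x \<in> pascal_source r s"
        by (rule nonconst_seqs_source)
      then show ?thesis by (intro UnionI[of "pascal_source r s"] UnI1 range_eqI[of _ _ "(r, s)"]) auto
    qed auto
  qed
  fix \<Omega> assume "\<Omega> \<in> ?C"
  then consider r s where "\<Omega> = pascal_source r s" | x where "\<Omega> = {x}"
    by auto
  then show "pascal_adic \<in> restrict_space borel \<Omega> \<rightarrow>\<^sub>M borel"
  proof cases
    case 1
    have "(\<lambda>x n. x (pascal_perm r s n)) \<in> restrict_space borel \<Omega> \<rightarrow>\<^sub>M borel"
      by (rule measurable_restrict_space1[OF measurable_reindex])
    moreover have "(\<lambda>n. x (pascal_perm r s n)) = pascal_adic x" if "x \<in> space (restrict_space borel \<Omega>)" for x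
      using that 1 by (simp add: pascal_adic_source space_restrict_space)
    ultimately show ?thesis
      by (simp cong: measurable_cong)
  next
    case 2
    have "(\<lambda>_. pascal_adic x) \<in> restrict_space borel \<Omega> \<rightarrow>\<^sub>M borel"
      by simp
    moreover have "pascal_adic x = pascal_adic z" if "z \<in> space (restrict_space borel \<Omega>)" for z
      using that 2 by (simp add: space_restrict_space)
    ultimately show ?thesis
      by (simp cong: measurable_cong)
  qed
qed

lemma measurable_pascal_inverse: "pascal_inverse \<in> borel \<rightarrow>\<^sub>M borel"
  unfolding pascal_inverse_def
  using measurable_compose[OF measurable_compose[OF measurable_flip measurable_pascal_adic] measurable_flip] .

lemma measurable_pascal_iter: "pascal_iter k \<in> borel \<rightarrow>\<^sub>M borel"
  unfolding pascal_iter_def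
  by (cases "0 \<le> k") (simp_all add: measurable_compose_n measurable_pascal_adic measurable_pascal_inverse)

lemma measurable_pascal_coding: "pascal_coding \<in> borel \<rightarrow>\<^sub>M borel"
proof (rule measurable_coordinatewise_then_product)
  fix k
  have "(\<lambda>x. pascal_iter k x 0) \<in> borel_measurable borel"
    by (rule measurable_compose[OF measurable_pascal_iter measurable_product_then_coordinatewise[OF measurable_ident_sets[OF refl]]])
  then have "(\<lambda>x. letter_of (pascal_iter k x 0)) \<in> borel \<rightarrow>\<^sub>M count_space UNIV"
    unfolding borel_measurable_countable_iff by (rule measurable_compose) simp
  then show "(\<lambda>x. pascal_coding x k) \<in> borel_measurable borel"
    unfolding borel_measurable_countable_iff pascal_coding_def .
qed

text \<open>The image consists of the \<open>y\<close> that decode into \<open>nonconst_seqs\<close>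
  and are restored by coding again, a Borel condition on countably many letters.\<close>

lemma sets_pascal_coding_image: "pascal_coding ` nonconst_seqs \<in> sets borel"
proof -
  note [measurable] = measurable_pascal_decode
  have [measurable]: "(\<lambda>y. pascal_coding (pascal_decode y) k) \<in> borel \<rightarrow>\<^sub>M count_space UNIV" for k
    by (rule measurable_compose[OF measurable_compose[OF measurable_pascal_decode measurable_pascal_coding] measurable_letter])
  have "{y \<in> space borel. pascal_decode y \<in> nonconst_seqs \<and>
      (\<forall>k. pascal_coding (pascal_decode y) k = y k)} \<in> sets borel"
    by measurable
  also have "{y \<in> space borel. pascal_decode y \<in> nonconst_seqs \<and>
      (\<forall>k. pascal_coding (pascal_decode y) k = y k)} = pascal_coding ` nonconst_seqs"
    by (auto simp: pascal_decode_coding fun_eq_iff[symmetric] intro: rev_image_eqI)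
  finally show ?thesis .
qed

lemma left_shift_zeta_subshift: "y \<in> zeta_subshift \<Longrightarrow> left_shift y \<in> zeta_subshift"
proof -
  assume y: "y \<in> zeta_subshift"
  have "map (left_shift y) [m..n] = map y [m + 1..n + 1]" for m n
    by (rule nth_equalityI) (auto simp: left_shift_def algebra_simps)
  then show ?thesis
    using y by (simp add: zeta_subshift_def)
qed

lemma measurable_left_shift:
  "left_shift \<in> restrict_space borel zeta_subshift \<rightarrow>\<^sub>M (restrict_space borel zeta_subshift :: (int \<Rightarrow> letter) measure)"
proof (rule measurable_restrict_space3)
  show "left_shift \<in> borel \<rightarrow>\<^sub>M (borel :: (int \<Rightarrow> letter) measure)"
    unfolding left_shift_def
    by (rule measurable_coordinatewise_then_product)
      (rule measurable_product_then_coordinatewise[OF measurable_ident_sets[OF refl]])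
qed (simp add: left_shift_zeta_subshift)

section \<open>Invariant measures and isomorphism\<close>

lemma space_bernoulli_measure [simp]: "space (bernoulli_measure \<alpha>) = UNIV"
  using sets_eq_imp_space_eq[OF sets_bernoulli_measure] by simp

lemma prob_space_bernoulli_measure: "prob_space (bernoulli_measure \<alpha>)"
  unfolding bernoulli_measure_def by (intro prob_space_PiM measure_pmf.prob_space_axioms)

lemma distr_bernoulli_measure_reindex:
  assumes "inj f"
  shows "distr (bernoulli_measure \<alpha>) (bernoulli_measure \<alpha>) (\<lambda>x n. x (f n)) = bernoulli_measure \<alpha>"
  using distr_PiM_reindex[of UNIV "\<lambda>_. measure_pmf (bernoulli_pmf (1 - \<alpha>))" f UNIV] assms
  by (simp add: bernoulli_measure_def measure_pmf.prob_space_axioms restrict_UNIV)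

text \<open>A point lies in the cylinder of its first \<open>n\<close> digits, whose mass is at most
  \<open>c ^ n\<close> with \<open>c = max \<alpha> (1 - \<alpha>) < 1\<close>. Hence points are
  null.\<close>

lemma null_sets_bernoulli_measure:
  assumes "0 < \<alpha>" "\<alpha> < 1" "countable X"
  shows "X \<in> null_sets (bernoulli_measure \<alpha>)"
proof -
  let ?M = "bernoulli_measure \<alpha>" and ?p = "bernoulli_pmf (1 - \<alpha>)"
  interpret prob_space ?M
    by (rule prob_space_bernoulli_measure)
  interpret P: product_prob_space "\<lambda>_::nat. measure_pmf ?p" UNIV
    by (intro product_prob_spaceI measure_pmf.prob_space_axioms)
  define c where "c = max \<alpha> (1 - \<alpha>)"
  have c: "0 \<le> c" "c < 1" and pmf: "pmf ?p b \<le> c" for b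
    using assms by (cases b; simp add: c_def)+
  have "prob {x} \<le> c ^ n" for x n
  proof -
    let ?C = "{y \<in> space ?M. \<forall>i\<in>{..<n}. y i \<in> {x i}}"
    have "emeasure ?M ?C = (\<Prod>i<n. emeasure (measure_pmf ?p) {x i})"
      unfolding bernoulli_measure_def by (intro P.emeasure_PiM_Collect) auto
    also have "\<dots> = ennreal (\<Prod>i<n. pmf ?p (x i))"
      by (simp add: emeasure_pmf_single prod_ennreal)
    also have "\<dots> \<le> ennreal (\<Prod>i<n. c)"
      by (intro ennreal_leI prod_mono) (simp add: pmf)
    finally have "prob ?C \<le> c ^ n"
      using c(1) by (simp add: emeasure_eq_measure)
    moreover have "?C \<in> sets ?M"
    proof -
      have "{y \<in> space borel. \<forall>i\<in>{..<n}. y i = x i} \<in> sets borel"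
        by measurable
      then show ?thesis
        by (simp add: sets_bernoulli_measure)
    qed
    then have "prob {x} \<le> prob ?C"
      by (intro finite_measure_mono) auto
    ultimately show ?thesis by simp
  qed
  moreover have "(\<lambda>n. c ^ n) \<longlonglongrightarrow> 0"
    using c by (intro LIMSEQ_power_zero) simp
  ultimately have "prob {x} \<le> 0" for x
    by (intro LIMSEQ_le_const[of "\<lambda>n. c ^ n"]) auto
  then have "{x} \<in> null_sets ?M" for x
    by (intro null_setsI) (simp_all add: emeasure_eq_measure measure_le_0_iff sets_bernoulli_measure sets_countable_sequences)
  then have "(\<Union>x\<in>X. {x}) \<in> null_sets ?M"
    by (intro null_sets_UN' assms)
  then show ?thesis by simp
qed

lemma pascal_source_unique:
  assumes "x \<in> pascal_source r s" "x \<in> pascal_source r' s'"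
  shows "r = r' \<and> s = s'"
proof -
  have x: "\<forall>n<r. \<not> x n" "\<forall>n. r \<le> n \<and> n \<le> r + s \<longrightarrow> x n" "\<not> x (Suc (r + s))"
    and x': "\<forall>n<r'. \<not> x n" "\<forall>n. r' \<le> n \<and> n \<le> r' + s' \<longrightarrow> x n" "\<not> x (Suc (r' + s'))"
    using assms by (auto simp: pascal_source_def)
  have r: "r = r'"
    using x x' by (metis le_add1 linorder_neqE_nat order_refl)
  have "\<not> s < s'" "\<not> s' < s"
    using x(2,3) x'(2,3) r by (auto dest: spec[of _ "Suc (r' + s)"] spec[of _ "Suc (r' + s')"])
  then show ?thesis
    using r by simp
qed

text \<open>Serves both the source and the target cylinders. The family misses only countably many
  points, which are null; the integral over the counting measure is the sum over all
  \<open>(r, s)\<close>.\<close>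

lemma emeasure_bernoulli_partition:
  assumes \<alpha>: "0 < \<alpha>" "\<alpha> < 1"
    and sets: "\<And>r s. C r s \<in> sets borel"
    and cover: "nonconst_seqs \<subseteq> (\<Union>r s. C r s)"
    and disj: "\<And>x r s r' s'. x \<in> C r s \<Longrightarrow> x \<in> C r' s' \<Longrightarrow> r = r' \<and> s = s'"
    and A: "A \<in> sets borel"
  shows "emeasure (bernoulli_measure \<alpha>) A =
    (\<integral>\<^sup>+(r, s). emeasure (bernoulli_measure \<alpha>) (A \<inter> C r s) \<partial>count_space (UNIV :: (nat \<times> nat) set))"
proof -
  let ?M = "bernoulli_measure \<alpha>" and ?D = "\<lambda>(r, s). A \<inter> C r s"
  note [simp] = sets_bernoulli_measure
  have "countable (- (\<Union>r s. C r s))"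
    using cover by (intro countable_subset[OF _ countable_nonconst_seqs_compl]) auto
  then have null: "- (\<Union>r s. C r s) \<in> null_sets ?M"
    by (rule null_sets_bernoulli_measure[OF \<alpha>])
  have "(\<integral>\<^sup>+(r, s). emeasure ?M (A \<inter> C r s) \<partial>count_space UNIV) = emeasure ?M (\<Union>p. ?D p)"
  proof -
    have "disjoint_family ?D"
      using disj by (fastforce simp: disjoint_family_on_def)
    then have "emeasure ?M (\<Union>p. ?D p) = (\<integral>\<^sup>+p. emeasure ?M (?D p) \<partial>count_space UNIV)"
      by (intro emeasure_UN_countable) (auto simp: A sets)
    then show ?thesis
      by (simp add: case_prod_unfold)
  qed
  also have "(\<Union>p. ?D p) = A - - (\<Union>r s. C r s)"
    by auto
  also have "emeasure ?M \<dots> = emeasure ?M A"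
    using null A by (intro emeasure_Diff_null_set) simp_all
  finally show ?thesis ..
qed

lemma sets_pascal_target: "pascal_target r s \<in> sets borel"
  using measurable_sets[OF measurable_flip sets_pascal_source[of s r]]
  by (simp add: pascal_target_def vimage_def)

lemma pascal_target_unique:
  "x \<in> pascal_target r s \<Longrightarrow> x \<in> pascal_target r' s' \<Longrightarrow> r = r' \<and> s = s'"
  unfolding pascal_target_def using pascal_source_unique by blast

lemma distr_bernoulli_measure_pascal_adic:
  assumes \<alpha>: "0 < \<alpha>" "\<alpha> < 1"
  shows "distr (bernoulli_measure \<alpha>) (bernoulli_measure \<alpha>) pascal_adic = bernoulli_measure \<alpha>"
proof (rule measure_eqI)
  let ?M = "bernoulli_measure \<alpha>"
  have meas: "f \<in> ?M \<rightarrow>\<^sub>M ?M" if "f \<in> borel \<rightarrow>\<^sub>M borel" for f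
    using that by (simp add: measurable_cong_sets[OF sets_bernoulli_measure sets_bernoulli_measure])
  fix A assume "A \<in> sets (distr ?M ?M pascal_adic)"
  then have A: "A \<in> sets borel"
    by (simp add: sets_bernoulli_measure)
  have inv: "pascal_adic -` A \<in> sets borel"
    using measurable_sets[OF measurable_pascal_adic A] by simp
  \<comment> \<open>The permutation preserves the measure on the whole space. By
    \<open>pascal_target_iff\<close> the preimage of a subset of the target lies in the source,
    where the permutation coincides with \<open>pascal_adic\<close>.\<close>
  have pieces: "emeasure ?M (pascal_adic -` A \<inter> pascal_source r s) = emeasure ?M (A \<inter> pascal_target r s)" for r s
  proof -
    let ?f = "\<lambda>x n. x (pascal_perm r s n)"
    have "A \<inter> pascal_target r s \<in> sets ?M"
      using A sets_pascal_target by (simp add: sets_bernoulli_measure)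
    then have "emeasure ?M (A \<inter> pascal_target r s) = emeasure ?M (?f -` (A \<inter> pascal_target r s) \<inter> space ?M)"
      using distr_bernoulli_measure_reindex[OF inj_pascal_perm, of \<alpha> r s]
      by (metis emeasure_distr meas measurable_reindex)
    also have "?f -` (A \<inter> pascal_target r s) \<inter> space ?M = pascal_adic -` A \<inter> pascal_source r s"
      by (auto simp: pascal_target_iff pascal_adic_source)
    finally show ?thesis ..
  qed
  have source_cover: "nonconst_seqs \<subseteq> (\<Union>r s. pascal_source r s)"
  proof
    fix x assume "x \<in> nonconst_seqs"
    then obtain r s where "x \<in> pascal_source r s"
      by (rule nonconst_seqs_source)
    then show "x \<in> (\<Union>r s. pascal_source r s)"
      by blast
  qed
  have target_cover: "nonconst_seqs \<subseteq> (\<Union>r s. pascal_target r s)"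
  proof
    fix x assume "x \<in> nonconst_seqs"
    then obtain r s where "x \<in> pascal_target r s"
      by (rule nonconst_seqs_target)
    then show "x \<in> (\<Union>r s. pascal_target r s)"
      by blast
  qed
  have "emeasure ?M (pascal_adic -` A) =
      (\<integral>\<^sup>+(r, s). emeasure ?M (pascal_adic -` A \<inter> pascal_source r s) \<partial>count_space UNIV)"
    using \<alpha> sets_pascal_source source_cover pascal_source_unique inv
    by (rule emeasure_bernoulli_partition)
  also have "\<dots> = (\<integral>\<^sup>+(r, s). emeasure ?M (A \<inter> pascal_target r s) \<partial>count_space UNIV)"
    by (simp only: pieces)
  also have "\<dots> = emeasure ?M A"
    using \<alpha> sets_pascal_target target_cover pascal_target_unique A
    by (rule emeasure_bernoulli_partition[symmetric])
  finally have "emeasure ?M (pascal_adic -` A) = emeasure ?M A" .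
  then show "emeasure (distr ?M ?M pascal_adic) A = emeasure ?M A"
    using A by (simp add: emeasure_distr meas measurable_pascal_adic sets_bernoulli_measure)
qed (simp add: sets_bernoulli_measure)

section \<open>Isomorphism from an injective coding\<close>

text \<open>The measurable left inverse \<open>g\<close> agrees with the inverse of \<open>h\<close>
  on the measurable image, which gives bimeasurability at once.\<close>

lemma measurably_isomorphic_distr:
  assumes M: "measure_preserving_system M S"
    and A: "A \<in> sets M" "emeasure M A = 1" "S ` A \<subseteq> A"
    and h: "h \<in> restrict_space M A \<rightarrow>\<^sub>M N"
    and R: "R \<in> N \<rightarrow>\<^sub>M N"
    and g: "g \<in> N \<rightarrow>\<^sub>M M" "\<And>x. x \<in> A \<Longrightarrow> g (h x) = x"
    and image: "h ` A \<in> sets N"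
    and equiv: "\<And>x. x \<in> A \<Longrightarrow> h (S x) = R (h x)"
  shows "measurably_isomorphic M S (distr (restrict_space M A) N h) R"
proof -
  let ?A = "restrict_space M A" and ?B = "h ` A"
  let ?N = "distr ?A N h"
  interpret M: prob_space M
    using M by (simp add: measure_preserving_system_def)
  have S: "S \<in> M \<rightarrow>\<^sub>M M" and distr_S: "distr M M S = M"
    using M by (simp_all add: measure_preserving_system_def)
  have AM: "A \<inter> space M = A"
    using sets.sets_into_space[OF A(1)] by blast
  have space_A [simp]: "space ?A = A"
    by (simp add: space_restrict_space AM)
  have h_space: "h x \<in> space N" if "x \<in> A" for x
    using measurable_space[OF h, of x] that by simp
  have emeasure_A: "emeasure ?A X = emeasure M X" if "X \<subseteq> A" for X
    using that A(1) by (intro emeasure_restrict_space) (simp_all add: AM)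
  have SA: "S \<in> ?A \<rightarrow>\<^sub>M ?A"
    using S A(3) by (intro measurable_restrict_space3) auto
  \<comment> \<open>Restricting to \<open>A\<close> keeps the measure invariant because
    \<open>A\<close> has full measure, so the two preimages below agree almost everywhere.\<close>
  have distr_SA: "distr ?A ?A S = ?A"
  proof (rule measure_eqI)
    fix X assume "X \<in> sets (distr ?A ?A S)"
    then have X: "X \<subseteq> A" "X \<in> sets M" "X \<in> sets ?A"
      using A(1) by (auto simp: sets_restrict_space_iff AM)
    have "emeasure (distr ?A ?A S) X = emeasure M (S -` X \<inter> A)"
      using X SA by (simp add: emeasure_distr emeasure_A)
    also have "\<dots> = emeasure M (S -` X \<inter> space M)"
    proof (rule emeasure_eq_AE)
      have "AE x in M. x \<in> A"
        using A M.emeasure_eq_1_AE M.prob_eq_1 by (simp add: M.emeasure_eq_measure)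
      then show "AE x in M. x \<in> S -` X \<inter> A \<longleftrightarrow> x \<in> S -` X \<inter> space M"
        by eventually_elim (use AM in auto)
      show "S -` X \<inter> space M \<in> sets M"
        using measurable_sets[OF S X(2)] .
      then have "(S -` X \<inter> space M) \<inter> A \<in> sets M"
        using A(1) by blast
      also have "(S -` X \<inter> space M) \<inter> A = S -` X \<inter> A"
        using AM by blast
      finally show "S -` X \<inter> A \<in> sets M" .
    qed
    also have "\<dots> = emeasure M X"
      using emeasure_distr[OF S X(2)] distr_S by simp
    finally show "emeasure (distr ?A ?A S) X = emeasure ?A X"
      using X by (simp add: emeasure_A)
  qed simp
  have prob_A: "prob_space ?A"
    by (rule prob_spaceI) (simp add: emeasure_A A(2))
  have prob_N: "prob_space ?N"
    by (rule prob_space.prob_space_distr[OF prob_A h])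
  have emeasure_N: "emeasure ?N X = emeasure M (h -` X \<inter> A)" if "X \<in> sets N" for X
    using that h by (simp add: emeasure_distr emeasure_A)
  \<comment> \<open>Pushing forward by \<open>h\<close> and then \<open>R\<close> equals pushing
    forward by \<open>S\<close> and then \<open>h\<close>, and \<open>S\<close> fixes the restricted
    measure.\<close>
  have "distr ?N ?N R = distr ?A N (R \<circ> h)"
    using distr_distr[OF R h] by (simp cong: distr_cong)
  also have "\<dots> = distr ?A N (h \<circ> S)"
    by (intro distr_cong) (simp_all add: equiv)
  also have "\<dots> = distr (distr ?A ?A S) N h"
    using distr_distr[OF h SA] by simp
  finally have distr_R: "distr ?N ?N R = ?N"
    by (simp add: distr_SA)
  have N: "measure_preserving_system ?N R"
    unfolding measure_preserving_system_def using prob_N distr_R R by simp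
  have B1: "emeasure ?N ?B = 1"
  proof -
    have "h -` ?B \<inter> A = A" by blast
    then show ?thesis using emeasure_N[OF image] A(2) by simp
  qed
  have BN: "?B \<inter> space ?N = ?B"
    using h_space by auto
  have bij: "bij_betw h A ?B"
    unfolding bij_betw_def by (metis g(2) inj_onI)
  have inv: "the_inv_into A h y = g y" if "y \<in> ?B" for y
    using that bij g(2) by (auto simp: bij_betw_def the_inv_into_f_f)
  have hN: "h \<in> ?A \<rightarrow>\<^sub>M restrict_space ?N ?B"
    using h by (intro measurable_restrict_space2) auto
  have "g \<in> restrict_space ?N ?B \<rightarrow>\<^sub>M ?A"
    using g by (intro measurable_restrict_space3) auto
  then have inv_meas: "the_inv_into A h \<in> restrict_space ?N ?B \<rightarrow>\<^sub>M ?A"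
    by (rule measurable_cong[THEN iffD2, rotated]) (simp add: inv space_restrict_space)
  have distr_h: "distr ?A (restrict_space ?N ?B) h = restrict_space ?N ?B"
  proof (rule measure_eqI)
    fix X assume "X \<in> sets (distr ?A (restrict_space ?N ?B) h)"
    then have X: "X \<subseteq> ?B" "X \<in> sets N" "X \<in> sets (restrict_space ?N ?B)"
      using image BN by (auto simp: sets_restrict_space_iff)
    have "emeasure (restrict_space ?N ?B) X = emeasure ?N X"
      using X(1) image BN by (intro emeasure_restrict_space) simp_all
    then show "emeasure (distr ?A (restrict_space ?N ?B) h) X = emeasure (restrict_space ?N ?B) X"
      using X hN by (simp add: emeasure_distr emeasure_A emeasure_N)
  qed simp
  have "R (h x) \<in> ?B" if "x \<in> A" for x
    using that A(3) equiv[OF that, symmetric] by (simp add: image_subset_iff)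
  then have RB: "R ` ?B \<subseteq> ?B"
    by blast
  have equiv': "\<forall>x\<in>A. h (S x) = R (h x)"
    using equiv by blast
  have "?B \<in> sets ?N"
    using image by simp
  then show ?thesis
    unfolding measurably_isomorphic_def
    using M N A B1 RB bij hN inv_meas distr_h equiv' by blast
qed

theorem theorem4p1:
  shows "\<exists>(X' :: (nat \<Rightarrow> bool) set) (\<phi> :: (nat \<Rightarrow> bool) \<Rightarrow> (int \<Rightarrow> letter)).
    countable X' \<and>
    \<phi> \<in> restrict_space borel (UNIV - X') \<rightarrow>\<^sub>M restrict_space borel zeta_subshift \<and>
    inj_on \<phi> (UNIV - X') \<and>
    pascal_adic ` (UNIV - X') \<subseteq> UNIV - X' \<and>
    (\<forall>x \<in> UNIV - X'. \<phi> (pascal_adic x) = left_shift (\<phi> x)) \<and>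
    (\<forall>\<alpha>::real. 0 < \<alpha> \<and> \<alpha> < 1 \<longrightarrow>
      measurably_isomorphic
        (bernoulli_measure \<alpha>) pascal_adic
        (distr (restrict_space (bernoulli_measure \<alpha>) (UNIV - X'))
               (restrict_space borel zeta_subshift) \<phi>) left_shift)"
proof -
  let ?\<Sigma> = "restrict_space borel zeta_subshift"
  \<comment> \<open>The exceptional set is \<open>- nonconst_seqs\<close>, so its complement in the
    statement is a double complement.\<close>
  have compl: "UNIV - - nonconst_seqs = nonconst_seqs"
    by auto
  have coding: "pascal_coding \<in> restrict_space borel nonconst_seqs \<rightarrow>\<^sub>M ?\<Sigma>"
    using measurable_pascal_coding pascal_coding_subshift by (intro measurable_restrict_space3) auto
  have "measurably_isomorphic (bernoulli_measure \<alpha>) pascal_adic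
      (distr (restrict_space (bernoulli_measure \<alpha>) nonconst_seqs) ?\<Sigma> pascal_coding) left_shift"
    if \<alpha>: "0 < \<alpha>" "\<alpha> < 1" for \<alpha>
  proof (rule measurably_isomorphic_distr)
    let ?M = "bernoulli_measure \<alpha>"
    interpret prob_space ?M
      by (rule prob_space_bernoulli_measure)
    show "measure_preserving_system ?M pascal_adic"
      unfolding measure_preserving_system_def
      using measurable_pascal_adic prob_space_axioms distr_bernoulli_measure_pascal_adic[OF \<alpha>]
      by (simp add: measurable_cong_sets[OF sets_bernoulli_measure sets_bernoulli_measure])
    show "nonconst_seqs \<in> sets ?M"
      by (simp add: sets_bernoulli_measure sets_nonconst_seqs)
    \<comment> \<open>Full measure follows since the exceptional set is countable.\<close>
    have "emeasure ?M (space ?M - - nonconst_seqs) = emeasure ?M (space ?M)"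
      by (intro emeasure_Diff_null_set null_sets_bernoulli_measure \<alpha>
          countable_nonconst_seqs_compl sets.top)
    then show "emeasure ?M nonconst_seqs = 1"
      using emeasure_space_1 by (simp add: compl)
    show "pascal_coding \<in> restrict_space ?M nonconst_seqs \<rightarrow>\<^sub>M ?\<Sigma>"
      using coding
      by (simp add: measurable_cong_sets[OF restrict_space_sets_cong[OF refl sets_bernoulli_measure] refl])
    show "pascal_decode \<in> ?\<Sigma> \<rightarrow>\<^sub>M ?M"
      using measurable_restrict_space1[OF measurable_pascal_decode]
      by (simp add: measurable_cong_sets[OF refl sets_bernoulli_measure])
    have "pascal_coding ` nonconst_seqs \<subseteq> zeta_subshift"
      using pascal_coding_subshift by blast
    then show "pascal_coding ` nonconst_seqs \<in> sets ?\<Sigma>"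
      using sets_pascal_coding_image by (auto simp: sets_restrict_space)
  qed (auto simp: measurable_left_shift pascal_adic_nonconst_seqs pascal_decode_coding pascal_coding_adic)
  then show ?thesis
    using countable_nonconst_seqs_compl coding
    by (intro exI[of _ "- nonconst_seqs"] exI[of _ pascal_coding])
      (auto simp: compl pascal_adic_nonconst_seqs pascal_coding_adic intro: inj_on_inverseI pascal_decode_coding)
qed

end
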